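(* Let $S$ be an almost feasible solution of an instance of the Vehicle Routing with Drones problem, and let $G(S)$ be its graph (a directed multigraph). Then $S$ is consistent (and thus feasible) if and only if every directed cycle of $G(S)$ contains the depot or contains two consecutive drone-only edges representing different drones.
   Context: **Instance.** Numbers $n_t, n_d, n_p \in \mathbb{N}$ of trucks, drones and packages, together with integer positions of the packages in the plane (different from $(0,0)$, the position of the depot; the positions play no role in the notions below). The nodes are $0,1,\dots,n_p$, where $0$ is the depot and $1,\dots,n_p$ are the packages; between any two distinct nodes one can travel in either direction. The vehicles are the trucks $1,\dots,n_t$ and the drones $1,\dots,n_d$. **Tours and solutions.** A tour is a directed cycle (all its nodes distinct; length two is allowed) on these nodes which contains the depot and at least one package node. A truck tour is a tour with edge set $E$ together with a function $\mathrm{carry}: E \to \mathcal{P}(\{1,\dots,n_d\})$ (power set), giving the set of drones carried by the truck on each edge. A drone tour is a tour with edge set $E$ together with a function $\mathrm{carried}: E \to \{0,1,\dots,n_t\}$, giving the truck on which the drone rides on each edge, where $0$ means the drone flies on its own. A solution consists of one truck tour $T_{t}$ for each truck $t$ and one drone tour $T_{d}$ for each drone $d$. Each tour is regarded as starting with its edge leaving the depot and ending with its edge entering the depot; this gives the order of its edges, and "previous edges" refers to this order. **Feasibility.** A solution is feasible if: 1. Each node other than the depot is visited either only by a single drone, or only by one truck together with the drones that this truck carries when arriving at the node and the drones that it carries when leaving the node (no other vehicle visits it). 2. Vehicles that arrive at the depot stay there. 3. Each node is visited by at least one vehicle. 4. In each drone tour, the number of consecutive edges $e$ with $\mathrm{carried}(e)=0$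 is at most two (not counting around the depot). 5. The solution is consistent, i.e. both of the following hold: - (Carry consistency) For each edge $e$ of the tour of a truck $t$ and each $d \in \mathrm{carry}(e)$, the drone tour $T_d$ contains the edge $e$ and its carry function satisfies $\mathrm{carried}(e)=t$. Conversely, for each edge $e$ of the tour of a drone $d$ with $\mathrm{carried}(e)=t\neq 0$, the truck tour $T_t$ contains the edge $e$ and its carry function satisfies $d\in\mathrm{carry}(e)$. - (Schedule consistency) Given carry consistency, call two edges (of tours of vehicles) essentially equal if the corresponding vehicles travel this edge together, i.e. an edge $e$ of a truck's tour is essentially equal to the copies of $e$ in the tours of all drones in $\mathrm{carry}(e)$, and these copies are essentially equal to each other. This partitions the set of all edges of all tours. Edges mapped to $0$ or $\emptyset$ by the respective carry function are essentially equal only to themselves. Consider the following marking process. In the first step, mark all edges leaving the depot. In each further step, let $E^*$ be the set of those edges all of whose previous edges (in their own tour) are already marked, and mark every edge of $E^*$ for which all edges essentially equal to it are also in $E^*$. Schedule consistency requires that this process leads to every edge of every tour being marked. **Almost feasible.** A solution is almost feasible if it satisfies everything required for feasibility except possibly schedule consistency (in particular carry consistency holds). **Graph of a solution.** The graph $G(S)$ of a solution $S$ is the directed multigraph with nodes $0,\dots,n_p$ whose edges are the union, with multiplicity, of the edges of all truck and drone tours (one edge for each edge of each vehicle's tour). Each edge is labelled by the vehicle it represents and inherits the value of the carry function of that vehicle's tour. **Drone-only edges and cycles.** A drone-only edge is an edge of $G(S)$ representing a drone that flies on its own on it (i.e. $\mathrm{carried}=0$). Directed cycles have pairwise distinct nodes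 (length two is allowed), and "consecutive" is understood cyclically along the cycle. *)

theory Defs
  imports "Graph_Theory.Arc_Walk"
begin

record vrd_instance =
  n_trucks :: nat
  n_drones :: nat
  n_packages :: nat
  position :: "nat \<Rightarrow> int \<times> int"

definition is_instance :: "vrd_instance \<Rightarrow> bool" where
  "is_instance I \<longleftrightarrow> (\<forall>i \<in> {1..n_packages I}. position I i \<noteq> (0, 0))"

type_synonym edge = "nat \<times> nat"

definition travel_graph :: "vrd_instance \<Rightarrow> (nat, edge) pre_digraph" where
  "travel_graph I = \<lparr> verts = {0..n_packages I},
     arcs = {(u, v). u \<le> n_packages I \<and> v \<le> n_packages I \<and> u \<noteq> v},
     tail = fst, head = snd \<rparr>"

text \<open>A tour is stored as the list of its edges in order of travel, so the list starts
  with the edge leaving the depot, node 0.\<close>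

definition is_tour :: "vrd_instance \<Rightarrow> edge list \<Rightarrow> bool" where
  "is_tour I es \<longleftrightarrow> pre_digraph.cycle (travel_graph I) es \<and> fst (hd es) = 0
     \<and> (\<exists>i \<in> {1..n_packages I}. i \<in> fst ` set es)"

datatype vehicle = Truck nat | Drone nat

text \<open>Vehicles are numbered from 1. The functions \<open>carry\<close> and \<open>carried\<close> take a vehicle number
  first; their values matter only on the edges of the tour of that vehicle.\<close>

record vrd_solution =
  truck_tour :: "nat \<Rightarrow> edge list"
  carry :: "nat \<Rightarrow> edge \<Rightarrow> nat set"
  drone_tour :: "nat \<Rightarrow> edge list"
  carried :: "nat \<Rightarrow> edge \<Rightarrow> nat"

definition is_solution :: "vrd_instance \<Rightarrow> vrd_solution \<Rightarrow> bool" where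
  "is_solution I S \<longleftrightarrow>
     (\<forall>t \<in> {1..n_trucks I}. is_tour I (truck_tour S t) \<and>
        (\<forall>e \<in> set (truck_tour S t). carry S t e \<subseteq> {1..n_drones I})) \<and>
     (\<forall>d \<in> {1..n_drones I}. is_tour I (drone_tour S d) \<and>
        (\<forall>e \<in> set (drone_tour S d). carried S d e \<in> {0..n_trucks I}))"

definition vehicles :: "vrd_instance \<Rightarrow> vehicle set" where
  "vehicles I = Truck ` {1..n_trucks I} \<union> Drone ` {1..n_drones I}"

fun tour_of :: "vrd_solution \<Rightarrow> vehicle \<Rightarrow> edge list" where
  "tour_of S (Truck t) = truck_tour S t"
| "tour_of S (Drone d) = drone_tour S d"

text \<open>The arc \<open>(v, e)\<close> is the copy of the edge \<open>e\<close> contributed by the vehicle \<open>v\<close>. As the edges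
  of a tour are pairwise distinct, this is the union with multiplicity.\<close>

type_synonym varc = "vehicle \<times> edge"

definition solution_graph :: "vrd_instance \<Rightarrow> vrd_solution \<Rightarrow> (nat, varc) pre_digraph" where
  "solution_graph I S = \<lparr> verts = {0..n_packages I},
     arcs = {(v, e). v \<in> vehicles I \<and> e \<in> set (tour_of S v)},
     tail = (\<lambda>(v, e). fst e), head = (\<lambda>(v, e). snd e) \<rparr>"

definition visitors :: "vrd_instance \<Rightarrow> vrd_solution \<Rightarrow> nat \<Rightarrow> vehicle set" where
  "visitors I S i = {v \<in> vehicles I. i \<in> fst ` set (tour_of S v)}"

definition carried_at :: "vrd_solution \<Rightarrow> nat \<Rightarrow> nat \<Rightarrow> nat set" where
  "carried_at S t i = (\<Union>e \<in> {e \<in> set (truck_tour S t). snd e = i \<or> fst e = i}. carry S t e)"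

definition package_condition :: "vrd_instance \<Rightarrow> vrd_solution \<Rightarrow> bool" where
  "package_condition I S \<longleftrightarrow> (\<forall>i \<in> {1..n_packages I}.
     (\<exists>d \<in> {1..n_drones I}. visitors I S i = {Drone d}) \<or>
     (\<exists>t \<in> {1..n_trucks I}. visitors I S i = {Truck t} \<union> Drone ` carried_at S t i))"

definition depot_condition :: "vrd_instance \<Rightarrow> vrd_solution \<Rightarrow> bool" where
  "depot_condition I S \<longleftrightarrow> (\<forall>v \<in> vehicles I. \<forall>es e es'.
     tour_of S v = es @ e # es' \<and> snd e = 0 \<longrightarrow> es' = [])"

definition visit_condition :: "vrd_instance \<Rightarrow> vrd_solution \<Rightarrow> bool" where
  "visit_condition I S \<longleftrightarrow> (\<forall>i \<in> {0..n_packages I}. visitors I S i \<noteq> {})"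

definition flight_condition :: "vrd_instance \<Rightarrow> vrd_solution \<Rightarrow> bool" where
  "flight_condition I S \<longleftrightarrow> (\<forall>d \<in> {1..n_drones I}. \<forall>es fs es'.
     drone_tour S d = es @ fs @ es' \<and> (\<forall>e \<in> set fs. carried S d e = 0) \<longrightarrow> length fs \<le> 2)"

definition carry_consistent :: "vrd_instance \<Rightarrow> vrd_solution \<Rightarrow> bool" where
  "carry_consistent I S \<longleftrightarrow>
     (\<forall>t \<in> {1..n_trucks I}. \<forall>e \<in> set (truck_tour S t). \<forall>d \<in> carry S t e.
        e \<in> set (drone_tour S d) \<and> carried S d e = t) \<and>
     (\<forall>d \<in> {1..n_drones I}. \<forall>e \<in> set (drone_tour S d). \<forall>t. carried S d e = t \<and> t \<noteq> 0 \<longrightarrow>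
        e \<in> set (truck_tour S t) \<and> d \<in> carry S t e)"

definition essentially_equal :: "vrd_instance \<Rightarrow> vrd_solution \<Rightarrow> varc \<Rightarrow> varc \<Rightarrow> bool" where
  "essentially_equal I S a b \<longleftrightarrow> a = b \<or>
     (\<exists>t \<in> {1..n_trucks I}. \<exists>e \<in> set (truck_tour S t).
        {a, b} \<subseteq> {(Truck t, e)} \<union> (\<lambda>d. (Drone d, e)) ` carry S t e)"

definition previous_arcs :: "vrd_solution \<Rightarrow> varc \<Rightarrow> varc set" where
  "previous_arcs S = (\<lambda>(v, e). Pair v ` set (takeWhile (\<lambda>e'. e' \<noteq> e) (tour_of S v)))"

definition ready :: "vrd_instance \<Rightarrow> vrd_solution \<Rightarrow> varc set \<Rightarrow> varc set" where
  "ready I S M = {a \<in> arcs (solution_graph I S). previous_arcs S a \<subseteq> M}"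

text \<open>\<open>marked I S k\<close> is the set of arcs marked after step \<open>k + 1\<close> of the marking process.\<close>

primrec marked :: "vrd_instance \<Rightarrow> vrd_solution \<Rightarrow> nat \<Rightarrow> varc set" where
  "marked I S 0 = {a \<in> arcs (solution_graph I S). tail (solution_graph I S) a = 0}"
| "marked I S (Suc k) = marked I S k \<union>
     {a \<in> ready I S (marked I S k).
        \<forall>b \<in> arcs (solution_graph I S). essentially_equal I S a b \<longrightarrow> b \<in> ready I S (marked I S k)}"

definition schedule_consistent :: "vrd_instance \<Rightarrow> vrd_solution \<Rightarrow> bool" where
  "schedule_consistent I S \<longleftrightarrow> (\<forall>a \<in> arcs (solution_graph I S). \<exists>k. a \<in> marked I S k)"

definition consistent :: "vrd_instance \<Rightarrow> vrd_solution \<Rightarrow> bool" where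
  "consistent I S \<longleftrightarrow> carry_consistent I S \<and> schedule_consistent I S"

definition feasible :: "vrd_instance \<Rightarrow> vrd_solution \<Rightarrow> bool" where
  "feasible I S \<longleftrightarrow> package_condition I S \<and> depot_condition I S \<and> visit_condition I S \<and>
     flight_condition I S \<and> consistent I S"

definition almost_feasible :: "vrd_instance \<Rightarrow> vrd_solution \<Rightarrow> bool" where
  "almost_feasible I S \<longleftrightarrow> package_condition I S \<and> depot_condition I S \<and> visit_condition I S \<and>
     flight_condition I S \<and> carry_consistent I S"

fun drone_only :: "vrd_solution \<Rightarrow> varc \<Rightarrow> bool" where
  "drone_only S (Truck t, e) \<longleftrightarrow> False"
| "drone_only S (Drone d, e) \<longleftrightarrow> carried S d e = 0"

definition contains_depot :: "vrd_instance \<Rightarrow> vrd_solution \<Rightarrow> varc list \<Rightarrow> bool" where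
  "contains_depot I S p \<longleftrightarrow> 0 \<in> tail (solution_graph I S) ` set p"

text \<open>The vehicle of a drone-only arc is a drone, so comparing first components compares drones.\<close>

definition has_drone_change :: "vrd_solution \<Rightarrow> varc list \<Rightarrow> bool" where
  "has_drone_change S p \<longleftrightarrow> (\<exists>i < length p.
     let a = p ! i; b = p ! (Suc i mod length p)
     in drone_only S a \<and> drone_only S b \<and> fst a \<noteq> fst b)"

end

theory Submission
  imports Defs "Graph_Theory.Digraph_Component"
begin

text \<open>Only schedule consistency is at stake: the marking process must not get stuck. It gets stuck
  exactly when some arcs wait for each other in a circle, and the point is to see such a circle
  as a cycle of the graph itself, although waiting passes from an arc to its essentially equal
  copies and from there to the previous arc of another vehicle.

  Suppose that a cycle avoids the depot and contains no drone change. At each of its nodes the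
  package condition forces the incoming and the outgoing arc to have copies travelled one after the
  other by a common vehicle (\<open>handover\<close>): a drone that takes off alone at a node also
  visited by a truck was carried to it by that truck, and a drone that lands there alone is carried
  away. So each arc of the cycle must wait for the one before it. No arc of the
  cycle can be the first to be marked (\<open>never_marked_if_on_cycle\<close>).

  Conversely, suppose that some arcs are never marked. Such an arc, or a copy of it, has an unmarked
  predecessor, and following predecessors backwards never reaches the depot. Any walk of this kind
  closes up eventually, but the arc that closes it need not be the one that was followed, and
  a drone change could appear there. Therefore the arc by which a node is
  entered is chosen depending on the node alone, preferring arcs that are not drone-only
  (\<open>never_marked_entry\<close>). If only drone-only arcs are available and an unmarked drone-only arc
  leaves the node, then its drone flies alone both into and out of the node, hence is the only visitor, and
  again there is no drone change. The chosen arcs form a finite graph in which one can walk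
  backwards forever, so it contains a cycle (\<open>cycle_of_never_marked_arcs\<close>).\<close>

section \<open>Cycles and tours as lists of edges\<close>

text \<open>Both sides list the nodes of the walk. The facts on cycles below are
  read off this equation, whose two copies of the end node cancel for a closed walk.\<close>

lemma cas_tails_heads:
  "pre_digraph.cas G u p w \<Longrightarrow> map (tail G) p @ [w] = u # map (head G) p"
  by (induction p arbitrary: u) (auto simp: pre_digraph.cas.simps)

lemma cycle_tails_heads:
  assumes "pre_digraph.cycle G p"
  obtains u where "map (tail G) p @ [u] = u # map (head G) p"
proof -
  from assms obtain u where "pre_digraph.cas G u p u"
    by (auto simp: pre_digraph.cycle_def pre_digraph.awalk_def)
  from that[OF cas_tails_heads[OF this]] show thesis .
qed

lemma cycle_mset_tails_heads:
  assumes "pre_digraph.cycle G p"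
  shows "mset (map (tail G) p) = mset (map (head G) p)"
proof -
  obtain u where "map (tail G) p @ [u] = u # map (head G) p"
    using assms by (rule cycle_tails_heads)
  then have "mset (map (tail G) p @ [u]) = mset (u # map (head G) p)" by (rule arg_cong)
  then show ?thesis by simp
qed

lemma cycle_distinct_heads:
  assumes "pre_digraph.cycle G p"
  shows "distinct (map (head G) p)"
proof -
  from assms obtain u where u: "pre_digraph.cas G u p u" "distinct (tl (pre_digraph.awalk_verts G u p))"
    "p \<noteq> []"
    by (auto simp: pre_digraph.cycle_def pre_digraph.awalk_def)
  then show ?thesis by (simp add: pre_digraph.awalk_verts_conv'[OF u(1)])
qed

lemma cycle_distinct_tails:
  assumes "pre_digraph.cycle G p"
  shows "distinct (map (tail G) p)"
  using cycle_distinct_heads[OF assms] mset_eq_imp_distinct_iff[OF cycle_mset_tails_heads[OF assms]]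
  by blast

lemma cycle_consecutive:
  assumes "pre_digraph.cycle G p" and "i < length p"
  shows "head G (p ! i) = tail G (p ! (Suc i mod length p))"
proof -
  obtain u where u: "map (tail G) p @ [u] = u # map (head G) p"
    using assms(1) by (rule cycle_tails_heads)
  have head: "(map (tail G) p @ [u]) ! Suc i = head G (p ! i)"
    unfolding u using assms(2) by simp
  show ?thesis
  proof (cases "Suc i < length p")
    case True
    then show ?thesis using head by (simp add: nth_append)
  next
    case False
    with assms(2) have len: "Suc i = length p" by simp
    have "(map (tail G) p @ [u]) ! 0 = u" unfolding u by simp
    then have "tail G (p ! 0) = u" using assms(2) by (simp add: nth_append split: if_splits)
    moreover have "head G (p ! i) = u" using head len by (simp add: nth_append)
    ultimately show ?thesis using len by simp
  qed
qed

lemma cyclic_predecessor: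
  assumes "a \<in> set p"
  obtains i where "i < length p" and "p ! (Suc i mod length p) = a"
proof -
  obtain j where j: "j < length p" "p ! j = a" using assms by (auto simp: in_set_conv_nth)
  show thesis
  proof (cases j)
    case 0
    with j show thesis by (intro that[of "length p - 1"]) auto
  next
    case (Suc i)
    with j show thesis by (intro that[of i]) auto
  qed
qed

lemma tour_cycle:
  assumes "is_tour I es"
  shows "pre_digraph.cycle (travel_graph I) es"
  using assms by (simp add: is_tour_def)

lemma travel_graph_tail_head [simp]: "tail (travel_graph I) = fst" "head (travel_graph I) = snd"
  by (simp_all add: travel_graph_def)

lemma tour_edge_le:
  assumes "is_tour I es" and "e \<in> set es"
  shows "fst e \<le> n_packages I" and "snd e \<le> n_packages I"
proof -
  have "set es \<subseteq> arcs (travel_graph I)"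
    using tour_cycle[OF assms(1)] by (auto simp: pre_digraph.cycle_def pre_digraph.awalk_def)
  then show "fst e \<le> n_packages I" "snd e \<le> n_packages I"
    using assms(2) by (auto simp: travel_graph_def)
qed

lemma tour_tails_inj:
  assumes "is_tour I es" "e \<in> set es" "e' \<in> set es" "fst e = fst e'"
  shows "e = e'"
  using cycle_distinct_tails[OF tour_cycle[OF assms(1)]] assms(2-4)
  by (auto simp: distinct_map dest: inj_onD)

lemma tour_heads_inj:
  assumes "is_tour I es" "e \<in> set es" "e' \<in> set es" "snd e = snd e'"
  shows "e = e'"
  using cycle_distinct_heads[OF tour_cycle[OF assms(1)]] assms(2-4)
  by (auto simp: distinct_map dest: inj_onD)

lemma tour_tails_eq_heads:
  assumes "is_tour I es"
  shows "fst ` set es = snd ` set es"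
  using cycle_mset_tails_heads[OF tour_cycle[OF assms]]
  by (metis mset_eq_setD set_map travel_graph_tail_head)

text \<open>The condition on previous edges is stated with one step of unfolding only, which is the
  form in which waiting propagates from an edge to the edge just before it.\<close>

lemma tour_predecessor:
  assumes tour: "is_tour I es" and "e' \<in> set es" and "fst e' \<noteq> 0"
  obtains e where "e \<in> set es" and "snd e = fst e'"
    and "set (takeWhile (\<lambda>x. x \<noteq> e') es) = insert e (set (takeWhile (\<lambda>x. x \<noteq> e) es))"
proof -
  obtain zs ys where es: "es = zs @ e' # ys" using assms(2) by (auto dest: split_list)
  have "zs \<noteq> []" using tour assms(3) es by (auto simp: is_tour_def)
  then obtain xs e where zs: "zs = xs @ [e]" by (metis rev_exhaust)
  have "distinct es"
    using cycle_distinct_tails[OF tour_cycle[OF tour]] by (simp add: distinct_map)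
  then have "takeWhile (\<lambda>x. x \<noteq> e') es = xs @ [e]" "takeWhile (\<lambda>x. x \<noteq> e) es = xs"
    by (auto simp: es zs takeWhile_append)
  moreover have "snd e = fst e'"
    using cycle_consecutive[OF tour_cycle[OF tour], of "length xs"] by (simp add: es zs nth_append)
  ultimately show thesis by (intro that[of e]) (auto simp: es zs)
qed

lemma tour_start_no_previous:
  assumes tour: "is_tour I es" and "e \<in> set es" and "fst e = 0"
  shows "takeWhile (\<lambda>x. x \<noteq> e) es = []"
proof -
  have "es \<noteq> []" using assms(2) by auto
  moreover have "hd es = e"
    using tour_tails_inj[OF tour hd_in_set[OF \<open>es \<noteq> []\<close>] assms(2)] tour assms(3)
    by (simp add: is_tour_def)
  ultimately show ?thesis by (cases es) auto
qed

section \<open>Vehicles travelling together\<close>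

text \<open>All copies of the edge of a truck: the classes of essential equality other than singletons
  have this form.\<close>

definition convoy :: "vrd_solution \<Rightarrow> nat \<Rightarrow> edge \<Rightarrow> varc set" where
  "convoy S t e = {(Truck t, e)} \<union> (\<lambda>d. (Drone d, e)) ` carry S t e"

lemma essentially_equal_convoy:
  "essentially_equal I S a b \<longleftrightarrow> a = b \<or>
     (\<exists>t \<in> {1..n_trucks I}. \<exists>e \<in> set (truck_tour S t). a \<in> convoy S t e \<and> b \<in> convoy S t e)"
  by (simp add: essentially_equal_def convoy_def)

lemma essentially_equal_refl: "essentially_equal I S a a"
  by (simp add: essentially_equal_def)

lemma essentially_equal_sym: "essentially_equal I S a b \<Longrightarrow> essentially_equal I S b a"
  unfolding essentially_equal_convoy by blast

lemma convoy_edge: "a \<in> convoy S t e \<Longrightarrow> snd a = e"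
  by (auto simp: convoy_def)

lemma essentially_equal_edge: "essentially_equal I S a b \<Longrightarrow> snd a = snd b"
  unfolding essentially_equal_convoy by (metis convoy_edge)

lemma solution_graph_tail_head [simp]:
  "tail (solution_graph I S) a = fst (snd a)" "head (solution_graph I S) a = snd (snd a)"
  by (simp_all add: solution_graph_def split_beta)

lemma solution_graph_verts [simp]: "verts (solution_graph I S) = {0..n_packages I}"
  by (simp add: solution_graph_def)

lemma in_arcs_solution_graph:
  "(v, e) \<in> arcs (solution_graph I S) \<longleftrightarrow> v \<in> vehicles I \<and> e \<in> set (tour_of S v)"
  by (simp add: solution_graph_def)

lemma vehicles_simps [simp]:
  "Truck t \<in> vehicles I \<longleftrightarrow> t \<in> {1..n_trucks I}"
  "Drone d \<in> vehicles I \<longleftrightarrow> d \<in> {1..n_drones I}"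
  by (auto simp: vehicles_def)

locale almost_feasible_solution =
  fixes I :: vrd_instance and S :: vrd_solution
  assumes solution: "is_solution I S"
    and almost_feasible: "almost_feasible I S"
begin

abbreviation G :: "(nat, varc) pre_digraph" where
  "G \<equiv> solution_graph I S"

abbreviation ess_eq :: "varc \<Rightarrow> varc \<Rightarrow> bool" (infix \<open>\<approx>\<close> 50) where
  "a \<approx> b \<equiv> essentially_equal I S a b"

lemma tour_of_vehicle: "v \<in> vehicles I \<Longrightarrow> is_tour I (tour_of S v)"
  using solution by (auto simp: is_solution_def vehicles_def)

lemma arc_tour:
  assumes "a \<in> arcs G"
  shows "is_tour I (tour_of S (fst a))" and "snd a \<in> set (tour_of S (fst a))"
  using assms tour_of_vehicle by (cases a; auto simp: in_arcs_solution_graph)+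

lemma wf_G: "wf_digraph G"
proof
  fix a assume "a \<in> arcs G"
  then show "tail G a \<in> verts G" "head G a \<in> verts G"
    using tour_edge_le[OF arc_tour] by simp_all
qed

lemma finite_arcs: "finite (arcs G)"
proof (rule finite_subset)
  show "arcs G \<subseteq> (SIGMA v : vehicles I. set (tour_of S v))"
    by (auto simp: solution_graph_def)
  show "finite (SIGMA v : vehicles I. set (tour_of S v))"
    by (intro finite_SigmaI) (auto simp: vehicles_def)
qed

lemma arc_eq_if_tail_eq:
  "\<lbrakk>a \<in> arcs G; b \<in> arcs G; fst a = fst b; tail G a = tail G b\<rbrakk> \<Longrightarrow> a = b"
  using tour_tails_inj arc_tour by (metis prod.collapse solution_graph_tail_head(1))

lemma arc_eq_if_head_eq:
  "\<lbrakk>a \<in> arcs G; b \<in> arcs G; fst a = fst b; head G a = head G b\<rbrakk> \<Longrightarrow> a = b"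
  using tour_heads_inj arc_tour by (metis prod.collapse solution_graph_tail_head(2))

lemma arc_predecessor:
  assumes "a \<in> arcs G" and "tail G a \<noteq> 0"
  obtains c where "c \<in> arcs G" and "fst c = fst a" and "head G c = tail G a"
    and "previous_arcs S a = insert c (previous_arcs S c)"
proof -
  obtain v e' where a: "a = (v, e')" by (rule prod.exhaust)
  have "is_tour I (tour_of S v)" "e' \<in> set (tour_of S v)" "fst e' \<noteq> 0"
    using arc_tour[OF assms(1)] assms(2) a by auto
  then obtain e where "e \<in> set (tour_of S v)" "snd e = fst e'"
    "set (takeWhile (\<lambda>x. x \<noteq> e') (tour_of S v)) =
       insert e (set (takeWhile (\<lambda>x. x \<noteq> e) (tour_of S v)))"
    by (rule tour_predecessor)
  with assms a show thesis
    by (intro that[of "(v, e)"]) (auto simp: previous_arcs_def in_arcs_solution_graph)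
qed

lemma previous_arc_if_head_eq_tail:
  assumes "a \<in> arcs G" "b \<in> arcs G" "fst a = fst b" "head G a = tail G b" "tail G b \<noteq> 0"
  shows "a \<in> previous_arcs S b"
proof -
  obtain c where c: "c \<in> arcs G" "fst c = fst b" "head G c = tail G b"
    "previous_arcs S b = insert c (previous_arcs S c)"
    using assms(2,5) by (rule arc_predecessor)
  then have "a = c" using assms by (intro arc_eq_if_head_eq) auto
  with c show ?thesis by simp
qed

lemma depot_arc_no_previous:
  assumes "a \<in> arcs G" and "tail G a = 0"
  shows "previous_arcs S a = {}"
  using tour_start_no_previous[OF arc_tour[OF assms(1)]] assms(2)
  by (simp add: previous_arcs_def split_beta)

lemma vehicle_visits_tail: "a \<in> arcs G \<Longrightarrow> fst a \<in> visitors I S (tail G a)"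
  by (cases a) (force simp: visitors_def in_arcs_solution_graph)

lemma vehicle_visits_head:
  assumes "a \<in> arcs G"
  shows "fst a \<in> visitors I S (head G a)"
proof -
  have "snd (snd a) \<in> fst ` set (tour_of S (fst a))"
    using tour_tails_eq_heads arc_tour[OF assms] by auto
  then show ?thesis using assms by (cases a) (auto simp: visitors_def in_arcs_solution_graph)
qed

lemma carry_consistent: "carry_consistent I S"
  using almost_feasible by (simp add: almost_feasible_def)

lemma carried_if_carry:
  assumes "t \<in> {1..n_trucks I}" "e \<in> set (truck_tour S t)" "d \<in> carry S t e"
  shows "(Drone d, e) \<in> arcs G" and "carried S d e = t"
  using carry_consistent assms solution
  unfolding carry_consistent_def in_arcs_solution_graph is_solution_def vehicles_simps tour_of.simps
  by blast+

lemma convoy_not_drone_only: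
  assumes "t \<in> {1..n_trucks I}" "e \<in> set (truck_tour S t)" "a \<in> convoy S t e"
  shows "\<not> drone_only S a"
  using assms carried_if_carry(2)[OF assms(1,2)] by (auto simp: convoy_def)

lemma in_convoy_if_not_drone_only:
  assumes "a \<in> arcs G" and "\<not> drone_only S a"
  obtains t where "t \<in> {1..n_trucks I}" "snd a \<in> set (truck_tour S t)" "a \<in> convoy S t (snd a)"
proof -
  obtain v e where Pair: "a = (v, e)" by (rule prod.exhaust)
  show thesis
  proof (cases v)
    case (Truck t)
    with Pair assms show thesis by (intro that[of t]) (auto simp: convoy_def in_arcs_solution_graph)
  next
    case (Drone d)
    with Pair assms have d: "d \<in> {1..n_drones I}" "e \<in> set (drone_tour S d)" "carried S d e \<noteq> 0"
      by (auto simp: in_arcs_solution_graph)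
    then have "e \<in> set (truck_tour S (carried S d e))" "d \<in> carry S (carried S d e) e"
      using carry_consistent unfolding carry_consistent_def by blast+
    moreover have "carried S d e \<in> {1..n_trucks I}"
      using solution d unfolding is_solution_def
      by (metis atLeastAtMost_iff less_one not_le)
    ultimately show thesis
      using that[of "carried S d e"] Pair Drone by (simp add: convoy_def)
  qed
qed

text \<open>The copy of a drone determines the truck because \<open>carried\<close> has a single value. This is
  what makes essential equality transitive.\<close>

lemma convoy_truck_unique:
  assumes "t \<in> {1..n_trucks I}" "e \<in> set (truck_tour S t)" "a \<in> convoy S t e"
    and "t' \<in> {1..n_trucks I}" "e \<in> set (truck_tour S t')" "a \<in> convoy S t' e"
  shows "t = t'"
  using assms carried_if_carry(2)[OF assms(1,2)] carried_if_carry(2)[OF assms(4,5)]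
  unfolding convoy_def by blast

text \<open>Two convoys with a common arc are the convoy of the same truck on the same edge.\<close>

lemma essentially_equal_trans:
  assumes "a \<approx> b" and "b \<approx> c"
  shows "a \<approx> c"
  using assms unfolding essentially_equal_convoy
  by (metis convoy_edge convoy_truck_unique)

lemma drone_only_essentially_equal:
  assumes "drone_only S a" and "a \<approx> b"
  shows "b = a"
  using assms convoy_not_drone_only unfolding essentially_equal_convoy by blast

lemma package_visitors:
  assumes "i \<in> {1..n_packages I}"
  obtains (drone) d where "visitors I S i = {Drone d}"
  | (truck) t where "t \<in> {1..n_trucks I}"
      "visitors I S i = {Truck t} \<union> Drone ` carried_at S t i"
  using almost_feasible assms unfolding almost_feasible_def package_condition_def by metis

lemma arc_head_package:
  assumes "a \<in> arcs G" and "head G a \<noteq> 0"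
  shows "head G a \<in> {1..n_packages I}"
  using wf_digraph.head_in_verts[OF wf_G assms(1)] assms(2) by simp

text \<open>A drone has only one arc out of a node. If it flies alone on that one, then it can share the
  node with the truck only by having been carried there.\<close>

lemma carried_in_if_flies_out:
  assumes "t \<in> {1..n_trucks I}" "d \<in> carried_at S t i"
    and "b \<in> arcs G" "drone_only S b" "fst b = Drone d" "tail G b = i"
  obtains e where "e \<in> set (truck_tour S t)" "d \<in> carry S t e" "snd e = i"
proof -
  obtain e where e: "e \<in> set (truck_tour S t)" "d \<in> carry S t e" "snd e = i \<or> fst e = i"
    using assms(2) by (auto simp: carried_at_def)
  note carried = carried_if_carry[OF assms(1) e(1,2)]
  have "fst e \<noteq> i"
  proof
    assume "fst e = i"
    then have "(Drone d, e) = b" using arc_eq_if_tail_eq[OF carried(1) assms(3)] assms(5,6) by simp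
    then show False using carried(2) assms(1,4) by auto
  qed
  with e that show thesis by blast
qed

lemma carried_out_if_flies_in:
  assumes "t \<in> {1..n_trucks I}" "d \<in> carried_at S t i"
    and "a \<in> arcs G" "drone_only S a" "fst a = Drone d" "head G a = i"
  obtains e where "e \<in> set (truck_tour S t)" "d \<in> carry S t e" "fst e = i"
proof -
  obtain e where e: "e \<in> set (truck_tour S t)" "d \<in> carry S t e" "snd e = i \<or> fst e = i"
    using assms(2) by (auto simp: carried_at_def)
  note carried = carried_if_carry[OF assms(1) e(1,2)]
  have "snd e \<noteq> i"
  proof
    assume "snd e = i"
    then have "(Drone d, e) = a" using arc_eq_if_head_eq[OF carried(1) assms(3)] assms(5,6) by simp
    then show False using carried(2) assms(1,4) by auto
  qed
  with e that show thesis by blast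
qed

lemma drone_only_is_drone:
  assumes "drone_only S a"
  obtains d where "fst a = Drone d"
  using assms by (cases "(S, a)" rule: drone_only.cases) auto

text \<open>A drone that shares a package node with a truck is carried on at least one side of it.\<close>

lemma only_visitor_if_flies_in_and_out:
  assumes arcs: "a \<in> arcs G" "b \<in> arcs G"
    and "drone_only S a" "drone_only S b" "fst a = fst b"
    and ab: "head G a = tail G b" "tail G b \<noteq> 0"
  shows "visitors I S (tail G b) = {fst b}"
proof -
  obtain d where b: "fst b = Drone d" using assms(4) by (rule drone_only_is_drone)
  have "tail G b \<in> {1..n_packages I}" using arc_head_package[OF arcs(1)] ab by simp
  then show ?thesis
  proof (cases rule: package_visitors)
    case (drone d')
    then show ?thesis using vehicle_visits_tail[OF arcs(2)] by auto
  next
    case (truck t)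
    with vehicle_visits_tail[OF arcs(2)] b have "d \<in> carried_at S t (tail G b)" by auto
    then obtain e where e: "e \<in> set (truck_tour S t)" "d \<in> carry S t e" "snd e = tail G b"
      using carried_in_if_flies_out[OF truck(1) _ arcs(2) assms(4) b] by blast
    note carried = carried_if_carry[OF truck(1) e(1,2)]
    have "(Drone d, e) = a"
      using arc_eq_if_head_eq[OF carried(1) arcs(1)] e(3) ab(1) assms(5) b by simp
    then have "carried S d e = 0" using assms(3) by auto
    with carried(2) truck(1) show ?thesis by simp
  qed
qed

text \<open>The package condition makes the two vehicles equal or associates both with one truck. Thus
  the wait of an arc for the arc before it may cross from one vehicle to another; the vehicle that
  witnesses the wait need not be one of the two given vehicles.\<close>

lemma handover:
  assumes arcs: "a \<in> arcs G" "b \<in> arcs G"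
    and ab: "head G a = tail G b" "tail G b \<noteq> 0"
    and no_change: "\<not> (drone_only S a \<and> drone_only S b \<and> fst a \<noteq> fst b)"
  obtains a' b' where "a' \<in> arcs G" "b' \<in> arcs G" "a \<approx> a'" "b \<approx> b'" "a' \<in> previous_arcs S b'"
proof -
  note handed_over = that
  \<comment> \<open>Essentially equal arcs run along the same edge, so one common vehicle is all that is needed.\<close>
  have witness: thesis if "a' \<in> arcs G" "b' \<in> arcs G" "a \<approx> a'" "b \<approx> b'" "fst a' = fst b'" for a' b'
    using that(3,4)[THEN essentially_equal_edge] ab
      previous_arc_if_head_eq_tail[OF that(1,2,5)]
    by (intro handed_over[OF that(1-4)]) simp
  have "tail G b \<in> {1..n_packages I}" using arc_head_package[OF arcs(1)] ab by simp
  then show thesis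
  proof (cases rule: package_visitors)
    case (drone d)
    then have "fst a = fst b"
      using vehicle_visits_tail[OF arcs(2)] vehicle_visits_head[OF arcs(1)] ab(1) by simp
    then show thesis using witness arcs essentially_equal_refl by blast
  next
    case (truck t)
    \<comment> \<open>The truck leading a convoy into or out of the node is the only truck visiting it.\<close>
    have convoy: "snd c \<in> set (truck_tour S t)" "c \<in> convoy S t (snd c)"
      if c: "c \<in> arcs G" "\<not> drone_only S c" "tail G c = tail G b \<or> head G c = tail G b" for c
    proof -
      obtain t' where t': "t' \<in> {1..n_trucks I}" "snd c \<in> set (truck_tour S t')"
        "c \<in> convoy S t' (snd c)"
        using c(1,2) by (rule in_convoy_if_not_drone_only)
      then have "(Truck t', snd c) \<in> arcs G" by (simp add: in_arcs_solution_graph)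
      from vehicle_visits_tail[OF this] vehicle_visits_head[OF this]
      have "Truck t' \<in> visitors I S (tail G b)" using c(3) by auto
      then have "t' = t" using truck(2) by auto
      with t' show "snd c \<in> set (truck_tour S t)" "c \<in> convoy S t (snd c)" by simp_all
    qed
    have same_convoy: "c \<approx> c'" if "c \<in> convoy S t e" "c' \<in> convoy S t e" "e \<in> set (truck_tour S t)"
      for c c' e
      using that truck(1) unfolding essentially_equal_convoy by blast
    have truck_arc: "(Truck t, e) \<in> arcs G" if "e \<in> set (truck_tour S t)" for e
      using that truck(1) by (simp add: in_arcs_solution_graph)
    have truck_convoy: "(Truck t, e) \<in> convoy S t e" for e by (simp add: convoy_def)
    have drone_convoy: "(Drone d, e) \<in> convoy S t e" if "d \<in> carry S t e" for d e
      using that by (simp add: convoy_def)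
    have on_board: "d \<in> carried_at S t (tail G b)" if "Drone d \<in> visitors I S (tail G b)" for d
      using that truck(2) by auto
    consider (same) "fst a = fst b" | (together) "\<not> drone_only S a" "\<not> drone_only S b"
      | (launch) "\<not> drone_only S a" "drone_only S b" | (land) "drone_only S a" "\<not> drone_only S b"
      using no_change by blast
    then show thesis
    proof cases
      case same
      then show thesis using witness arcs essentially_equal_refl by blast
    next
      case together
      \<comment> \<open>The truck itself travels both arcs.\<close>
      note a = convoy[OF arcs(1) together(1) disjI2[OF ab(1)]]
        and b = convoy[OF arcs(2) together(2) disjI1[OF refl]]
      show thesis
        by (rule witness[OF truck_arc[OF a(1)] truck_arc[OF b(1)]
              same_convoy[OF a(2) truck_convoy a(1)] same_convoy[OF b(2) truck_convoy b(1)]]) simp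
    next
      case launch
      \<comment> \<open>The drone of the outgoing arc arrived on the truck, so it also has a copy of the incoming arc.\<close>
      note a = convoy[OF arcs(1) launch(1) disjI2[OF ab(1)]]
      obtain d where b: "fst b = Drone d" using launch(2) by (rule drone_only_is_drone)
      then have "d \<in> carried_at S t (tail G b)"
        using on_board vehicle_visits_tail[OF arcs(2)] by simp
      then obtain e where e: "e \<in> set (truck_tour S t)" "d \<in> carry S t e" "snd e = tail G b"
        using carried_in_if_flies_out[OF truck(1) _ arcs(2) launch(2) b] by blast
      have "e = snd a"
        using arc_eq_if_head_eq[OF truck_arc[OF e(1)] truck_arc[OF a(1)]] e(3) ab(1) by simp
      with a e have "a \<approx> (Drone d, e)" using same_convoy drone_convoy by blast
      moreover have "(Drone d, e) \<in> arcs G" using carried_if_carry(1)[OF truck(1) e(1,2)] .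
      moreover have "fst (Drone d, e) = fst b" using b by simp
      ultimately show thesis using witness arcs(2) essentially_equal_refl by blast
    next
      case land
      \<comment> \<open>The drone of the incoming arc leaves on the truck, so it also has a copy of the outgoing arc.\<close>
      note b = convoy[OF arcs(2) land(2) disjI1[OF refl]]
      obtain d where a: "fst a = Drone d" using land(1) by (rule drone_only_is_drone)
      then have "d \<in> carried_at S t (tail G b)"
        using on_board vehicle_visits_head[OF arcs(1)] ab(1) by simp
      then obtain e where e: "e \<in> set (truck_tour S t)" "d \<in> carry S t e" "fst e = tail G b"
        using carried_out_if_flies_in[OF truck(1) _ arcs(1) land(1) a ab(1)] by blast
      have "e = snd b"
        using arc_eq_if_tail_eq[OF truck_arc[OF e(1)] truck_arc[OF b(1)]] e(3) by simp
      with b e have "b \<approx> (Drone d, e)" using same_convoy drone_convoy by blast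
      moreover have "(Drone d, e) \<in> arcs G" using carried_if_carry(1)[OF truck(1) e(1,2)] .
      moreover have "fst a = fst (Drone d, e)" using a by simp
      ultimately show thesis using witness arcs(1) essentially_equal_refl by blast
    qed
  qed
qed

section \<open>The marking process\<close>

lemma marked_subset_arcs: "marked I S k \<subseteq> arcs G"
  by (induction k) (auto simp: ready_def)

lemma marked_mono: "k \<le> l \<Longrightarrow> marked I S k \<subseteq> marked I S l"
  by (rule lift_Suc_mono_le[where f = "marked I S"]) auto

text \<open>The statement covers all copies of the arcs of the cycle because a wait is passed
  on through a copy that need not lie on the cycle.\<close>

lemma never_marked_if_on_cycle:
  assumes cycle: "pre_digraph.cycle G p"
    and "\<not> contains_depot I S p" and "\<not> has_drone_change S p"
    and "a \<in> set p" and "a \<approx> a'"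
  shows "a' \<notin> marked I S k"
  using assms(4,5)
proof (induction k arbitrary: a a')
  case 0
  then have "tail G a \<noteq> 0" using assms(2) by (auto simp: contains_depot_def)
  then have "tail G a' \<noteq> 0" using essentially_equal_edge[OF 0(2)] by simp
  then show ?case by simp
next
  case (Suc k)
  have arcs: "set p \<subseteq> arcs G"
    using cycle by (simp add: pre_digraph.cycle_def pre_digraph.awalk_def) blast
  obtain i where i: "i < length p" "p ! (Suc i mod length p) = a"
    using Suc.prems(1) by (rule cyclic_predecessor)
  define c where "c = p ! i"
  have c: "c \<in> set p" using i by (simp add: c_def)
  have "head G c = tail G a" using cycle_consecutive[OF cycle i(1)] i(2) by (simp add: c_def)
  moreover have "tail G a \<noteq> 0" using assms(2) Suc.prems(1) by (auto simp: contains_depot_def)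
  moreover have "\<not> (drone_only S c \<and> drone_only S a \<and> fst c \<noteq> fst a)"
    using assms(3) i by (auto simp: has_drone_change_def c_def Let_def)
  ultimately obtain c' a'' where handover: "c' \<in> arcs G" "a'' \<in> arcs G" "c \<approx> c'" "a \<approx> a''"
    "c' \<in> previous_arcs S a''"
    using handover[of c a] arcs c Suc.prems(1) by blast
  have "a' \<approx> a''"
    using essentially_equal_trans[OF essentially_equal_sym[OF Suc.prems(2)] handover(4)] .
  moreover have "a'' \<notin> ready I S (marked I S k)"
    using Suc.IH[OF c handover(3)] handover(5) by (auto simp: ready_def)
  ultimately show ?case using Suc.IH[OF Suc.prems] handover(2) by auto
qed

definition eventually_marked :: "varc set" where
  "eventually_marked = (\<Union>k. marked I S k)"

definition never_marked :: "varc set" where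
  "never_marked = arcs G - eventually_marked"

lemma schedule_consistent_iff: "schedule_consistent I S \<longleftrightarrow> never_marked = {}"
  by (auto simp: schedule_consistent_def never_marked_def eventually_marked_def)

text \<open>There are finitely many arcs, so the process becomes stationary; an arc that is not marked at
  that stage is blocked for good.\<close>

lemma eventually_marked_stage:
  obtains K where "eventually_marked = marked I S K"
proof -
  have "finite eventually_marked"
    using finite_arcs marked_subset_arcs
    by (rule_tac finite_subset) (auto simp: eventually_marked_def)
  then have "\<exists>K. eventually_marked \<subseteq> marked I S K"
  proof (rule finite_subset_induct'[where A = eventually_marked])
    show "\<exists>K. insert a F \<subseteq> marked I S K"
      if a: "a \<in> eventually_marked" and F: "\<exists>K. F \<subseteq> marked I S K" for a F
    proof -
      obtain k where "a \<in> marked I S k" using a by (auto simp: eventually_marked_def)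
      moreover obtain l where "F \<subseteq> marked I S l" using F ..
      ultimately have "insert a F \<subseteq> marked I S (max k l)"
        using marked_mono[of k "max k l"] marked_mono[of l "max k l"] by auto
      then show ?thesis ..
    qed
  qed auto
  then show thesis using that by (auto simp: eventually_marked_def)
qed

lemma previous_arcs_marked:
  assumes "a \<in> eventually_marked"
  shows "previous_arcs S a \<subseteq> eventually_marked"
proof -
  obtain k where "a \<in> marked I S k" using assms by (auto simp: eventually_marked_def)
  then have "previous_arcs S a \<subseteq> marked I S k"
    by (induction k) (use depot_arc_no_previous in \<open>auto simp: ready_def\<close>)
  then show ?thesis by (auto simp: eventually_marked_def)
qed

text \<open>A never marked arc is blocked by some previous arc of one of its copies. As the previous
  arcs of a marked arc are marked, the immediately preceding arc is then unmarked too.\<close>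

lemma never_marked_predecessor:
  assumes "a \<in> never_marked"
  obtains b c where "a \<approx> b" "c \<in> never_marked" "fst c = fst b" "head G c = tail G a"
proof -
  obtain K where K: "eventually_marked = marked I S K" by (rule eventually_marked_stage)
  have a: "a \<in> arcs G" "a \<notin> marked I S (Suc K)"
    using assms unfolding never_marked_def eventually_marked_def by blast+
  have "\<exists>b \<in> arcs G. a \<approx> b \<and> b \<notin> ready I S (marked I S K)"
    using a essentially_equal_refl[of I S a] unfolding marked.simps by blast
  then obtain b where b: "b \<in> arcs G" "a \<approx> b" "\<not> previous_arcs S b \<subseteq> eventually_marked"
    using K by (auto simp: ready_def)
  then have "tail G b \<noteq> 0" using depot_arc_no_previous by blast
  then obtain c where c: "c \<in> arcs G" "fst c = fst b" "head G c = tail G b"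
    "previous_arcs S b = insert c (previous_arcs S c)"
    using b(1) by (rule_tac arc_predecessor)
  then have "c \<in> never_marked"
    using b(3) previous_arcs_marked[of c] by (auto simp: never_marked_def)
  then show thesis using that[OF b(2)] c(2,3) essentially_equal_edge[OF b(2)] by simp
qed

lemma never_marked_not_depot: "a \<in> never_marked \<Longrightarrow> tail G a \<noteq> 0"
  by (auto simp: never_marked_def eventually_marked_def dest: spec[of _ 0])

text \<open>The entry arc \<open>c\<close> depends on the node alone, so that the closing step of a walk built
  from such arcs is as good as any other step.\<close>

lemma never_marked_entry:
  assumes "v \<in> tail G ` never_marked"
  obtains c where "c \<in> never_marked" "head G c = v"
    and "\<And>a. \<lbrakk>a \<in> never_marked; tail G a = v; drone_only S a; drone_only S c\<rbrakk> \<Longrightarrow> fst c = fst a"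
proof (cases "\<exists>c \<in> never_marked. head G c = v \<and> \<not> drone_only S c")
  case True
  then show thesis using that by blast
next
  case all_fly: False
  obtain a\<^sub>0 where "a\<^sub>0 \<in> never_marked" "tail G a\<^sub>0 = v" using assms by blast
  then obtain c where c: "c \<in> never_marked" "head G c = v"
    by (metis never_marked_predecessor)
  show thesis
  proof (rule that[OF c])
    fix a assume a: "a \<in> never_marked" "tail G a = v" "drone_only S a"
    obtain b c' where "a \<approx> b" and c': "c' \<in> never_marked" "fst c' = fst b" "head G c' = tail G a"
      using a(1) by (rule never_marked_predecessor)
    have "fst c' = fst a"
      using c'(2) drone_only_essentially_equal[OF a(3) \<open>a \<approx> b\<close>] by simp
    moreover have "drone_only S c'" using all_fly c' a(2) by blast
    ultimately have "visitors I S v = {fst a}"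
      using only_visitor_if_flies_in_and_out[of c' a] a c'(1,3) never_marked_not_depot[OF a(1)]
      by (auto simp: never_marked_def)
    then show "fst c = fst a"
      using vehicle_visits_head[of c] c by (auto simp: never_marked_def)
  qed
qed

text \<open>The chosen entry arcs \<open>f v\<close> span a subgraph \<open>H\<close> in which every node that matters has an
  incoming arc. Iterating the map \<open>g\<close> from a node to the tail of its entry arc
  repeats a node, which gives a closed walk in \<open>H\<close>, hence a cycle. Every arc of it is some
  \<open>f v\<close>, so no consecutive pair is a drone change.\<close>

lemma cycle_of_never_marked_arcs:
  assumes "never_marked \<noteq> {}"
  obtains p where "pre_digraph.cycle G p" "\<not> contains_depot I S p" "\<not> has_drone_change S p"
proof -
  let ?B = "tail G ` never_marked"
  have "\<forall>v \<in> ?B. \<exists>c. c \<in> never_marked \<and> head G c = v \<and>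
    (\<forall>a \<in> never_marked. tail G a = v \<and> drone_only S a \<and> drone_only S c \<longrightarrow> fst c = fst a)"
    by (metis never_marked_entry)
  then obtain f where f: "\<And>v. v \<in> ?B \<Longrightarrow> f v \<in> never_marked" "\<And>v. v \<in> ?B \<Longrightarrow> head G (f v) = v"
    "\<And>v a. \<lbrakk>v \<in> ?B; a \<in> never_marked; tail G a = v; drone_only S a; drone_only S (f v)\<rbrakk> \<Longrightarrow>
       fst (f v) = fst a"
    by metis
  define g where "g v = tail G (f v)" for v
  define H where "H = G\<lparr>arcs := f ` ?B\<rparr>"
  interpret G: wf_digraph G by (rule wf_G)
  have H_simps: "tail H = tail G" "head H = head G" "verts H = verts G" "arcs H = f ` ?B"
    by (simp_all add: H_def)
  have arcs_H: "arcs H \<subseteq> never_marked" unfolding H_simps(4) by (intro image_subsetI f(1))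
  then have arcs_H_G: "arcs H \<subseteq> arcs G" unfolding never_marked_def by (rule subset_trans) blast
  interpret H: wf_digraph H
  proof
    fix c assume "c \<in> arcs H"
    then have "c \<in> arcs G" using arcs_H_G by (rule subsetD[rotated])
    then show "tail H c \<in> verts H" "head H c \<in> verts H"
      unfolding H_simps by (rule G.tail_in_verts G.head_in_verts)+
  qed
  have g: "(g ^^ n) v \<in> ?B" if "v \<in> ?B" for n v
  proof (induction n)
    case (Suc n)
    then show ?case using imageI[OF f(1)] by (simp add: g_def del: solution_graph_tail_head)
  qed (use that in simp)
  have B_verts: "?B \<subseteq> verts H"
    unfolding H_simps never_marked_def using G.tail_in_verts by (intro image_subsetI) blast
  have walk: "H.awalk ((g ^^ n) v) (rev (map (\<lambda>k. f ((g ^^ k) v)) [0..<n])) v" if v: "v \<in> ?B" for n v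
  proof (induction n)
    case 0
    then show ?case using v B_verts by (auto simp: H.awalk_Nil_iff)
  next
    case (Suc n)
    have "f ((g ^^ n) v) \<in> arcs H" using g[OF v] by (simp add: H_simps del: solution_graph_tail_head)
    moreover have "head H (f ((g ^^ n) v)) = (g ^^ n) v" using f(2)[OF g[OF v]] by (simp add: H_simps)
    moreover have "tail H (f ((g ^^ n) v)) = (g ^^ Suc n) v" by (simp add: H_simps g_def)
    ultimately show ?case using Suc by (simp add: H.awalk_Cons_iff)
  qed
  obtain v\<^sub>0 where v0: "v\<^sub>0 \<in> ?B" using assms by (metis all_not_in_conv imageI)
  have "finite ?B"
    using finite_arcs unfolding never_marked_def by (intro finite_imageI finite_Diff)
  then have "finite (range (\<lambda>n. (g ^^ n) v\<^sub>0))"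
    by (rule finite_subset[rotated]) (intro image_subsetI g[OF v0])
  then have "\<not> inj (\<lambda>n. (g ^^ n) v\<^sub>0)" by (metis range_inj_infinite)
  then obtain i' j' where "(g ^^ i') v\<^sub>0 = (g ^^ j') v\<^sub>0" "i' \<noteq> j'" by (auto simp only: inj_def)
  then obtain i j where ij: "i < j" "(g ^^ i) v\<^sub>0 = (g ^^ j) v\<^sub>0"
    by (metis nat_neq_iff)
  define v where "v = (g ^^ i) v\<^sub>0"
  have "(g ^^ (j - i)) v = v"
    using ij fun_cong[OF funpow_add[of "j - i" i g], of v\<^sub>0] by (simp add: v_def)
  then have "H.closed_w (rev (map (\<lambda>k. f ((g ^^ k) v)) [0..<j - i]))"
    using walk[of v "j - i"] g[OF v0, of i] ij(1) by (simp add: H.closed_w_def flip: v_def) metis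
  then obtain p where p: "H.cycle p" using H.closed_w_imp_cycle by blast
  have "subgraph H G"
    using arcs_H_G by (simp add: subgraph_def compatible_def H_simps G.wf_digraph_axioms H.wf_digraph_axioms)
  then have cycle: "G.cycle p" using p by (rule G.subgraph_cycle)
  have p_H: "set p \<subseteq> arcs H" using p by (auto simp: H.cycle_def H.awalk_def)
  then have "\<not> contains_depot I S p"
    using arcs_H never_marked_not_depot unfolding contains_depot_def by fastforce
  moreover have "\<not> has_drone_change S p"
  proof
    assume "has_drone_change S p"
    then obtain i where i: "i < length p" "drone_only S (p ! i)"
      "drone_only S (p ! (Suc i mod length p))" "fst (p ! i) \<noteq> fst (p ! (Suc i mod length p))"
      by (auto simp: has_drone_change_def Let_def)
    define a where "a = p ! (Suc i mod length p)"
    have "Suc i mod length p < length p" using i(1) by (intro mod_less_divisor) auto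
    then have "a \<in> set p" unfolding a_def by (rule nth_mem)
    then have "a \<in> never_marked" using p_H arcs_H by (meson subsetD)
    moreover have "p ! i \<in> f ` ?B" using subsetD[OF p_H nth_mem[OF i(1)]] unfolding H_simps(4) .
    then obtain v where v: "v \<in> ?B" "p ! i = f v" by (rule imageE)
    moreover have "tail G a = v"
      using cycle_consecutive[OF cycle i(1)] f(2)[OF v(1)] v(2) by (simp add: a_def)
    ultimately have "fst (p ! i) = fst a" using f(3) i(2,3) by (simp add: a_def)
    with i(4) show False by (simp add: a_def)
  qed
  ultimately show thesis by (rule that[OF cycle])
qed

lemma schedule_consistent_iff_cycles:
  "schedule_consistent I S \<longleftrightarrow>
     (\<forall>p. pre_digraph.cycle G p \<longrightarrow> contains_depot I S p \<or> has_drone_change S p)"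
proof
  assume schedule: "schedule_consistent I S"
  show "\<forall>p. pre_digraph.cycle G p \<longrightarrow> contains_depot I S p \<or> has_drone_change S p"
  proof (intro allI impI, rule ccontr)
    fix p assume p: "pre_digraph.cycle G p" "\<not> (contains_depot I S p \<or> has_drone_change S p)"
    then have "hd p \<in> set p" "set p \<subseteq> arcs G"
      by (auto simp: pre_digraph.cycle_def pre_digraph.awalk_def)
    then obtain k where "hd p \<in> marked I S k"
      using schedule by (auto simp: schedule_consistent_def)
    then show False
      using never_marked_if_on_cycle[OF p(1) _ _ \<open>hd p \<in> set p\<close> essentially_equal_refl] p(2) by blast
  qed
next
  assume "\<forall>p. pre_digraph.cycle G p \<longrightarrow> contains_depot I S p \<or> has_drone_change S p"
  then show "schedule_consistent I S"
    using cycle_of_never_marked_arcs unfolding schedule_consistent_iff by blast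
qed

end

section \<open>Consistency and cycles\<close>

theorem theorem1:
  fixes I :: vrd_instance and S :: vrd_solution
  assumes "is_instance I"
    and "is_solution I S"
    and "almost_feasible I S"
  shows "(consistent I S \<longleftrightarrow>
            (\<forall>p. pre_digraph.cycle (solution_graph I S) p \<longrightarrow>
               contains_depot I S p \<or> has_drone_change S p))
       \<and> (feasible I S \<longleftrightarrow>
            (\<forall>p. pre_digraph.cycle (solution_graph I S) p \<longrightarrow>
               contains_depot I S p \<or> has_drone_change S p))"
proof -
  interpret almost_feasible_solution I S using assms(2,3) by unfold_locales
  have "consistent I S \<longleftrightarrow> schedule_consistent I S"
    using carry_consistent by (simp add: consistent_def)
  moreover have "feasible I S \<longleftrightarrow> consistent I S"
    using assms(3) by (auto simp: feasible_def almost_feasible_def)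
  ultimately show ?thesis using schedule_consistent_iff_cycles by simp
qed

end
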